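(* For every integer $n\ge 1$ and every sufficiently small $r>0$ (how small may depend on $n$), the homotopical rotation set $R$ of the billiard flow on $Q_n$ satisfies $$R\subset B(0,2\sqrt{2}).$$
   Context: Billiard. $Q_n=\mathbb{T}^2\setminus\bigcup_{i=0}^{n-1}D_i$, where $\mathbb{T}^2=\mathbb{R}^2/\mathbb{Z}^2$ and $D_i$ is the (open) disk of radius $r$ centered at $(i/n,0)$ mod $\mathbb{Z}^2$; $r$ is small, in particular the disks are pairwise disjoint. The billiard flow $S^t$ is the motion of a point particle with unit speed in $Q_n$ with elastic (specular) reflections at the boundaries of the disks. For a phase point $x_0$ write $S^tx_0=(x(t),x'(t))$ (position, velocity), and $S^{[0,T]}x_0=\{S^tx_0 : 0\le t\le T\}$ for a trajectory segment. Fundamental group. $\pi_1(Q_n)$ is the free group $F_{n+1}$ with free generators $a,b_1,\dots,b_n$. The generator $a$ corresponds to crossing the wall $\{0\}\times[r,1-r]$ (mod $\mathbb{Z}^2$) in the positive direction, and $b_i$ corresponds to crossing the wall $[\frac{i-1}{n}+r,\frac{i}{n}-r]\times\{0\}$ (mod $\mathbb{Z}^2$) in the positive direction; crossings in the negative directions correspond to the inverses. Cutting $Q_n$ along these walls gives a simply connected cell. To a trajectory segment $S^{[0,T]}x_0$ one associates the element $g\in\pi_1(Q_n)$ given by its wall-crossing word (equivalently, the class of the loop obtained by joining the two endpoints of $\{x(t):0\le t\le T\}$ to a base point inside the cell without crossing walls). Let $|g|=\mathrm{dist}(g,1)$ be the word length of $g$ (length of the reduced word) with respect to the free generators $a,b_1,\dots,b_n$.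 Cone. $\mathrm{Ends}(\pi_1(Q_n))$ is the ideal boundary (a Cantor set) of the free group, i.e. the set of infinite reduced words $w_0w_1w_2\dots$ in the letters $a^{\pm1},b_i^{\pm1}$ with its usual topology. Let $C=([0,\infty)\times \mathrm{Ends}(\pi_1(Q_n)))/(\{0\}\times \mathrm{Ends}(\pi_1(Q_n)))$ be the cone over it, with vertex $0$. For $\rho\ge0$, $B(0,\rho)=\{(s,e)\in C: s\le\rho\}$. Rotation set. $R\subset C$ is the set of all $(s,e)\in C$ for which there are trajectory segments $S^{[0,T_m]}x_m$ with $T_m\to\infty$ and associated elements $g_m\in\pi_1(Q_n)$ such that $|g_m|/T_m\to s$ and, if $s>0$, $g_m\to e$ (i.e. for each $k$ the initial subword of length $k$ of the reduced word of $g_m$ eventually equals that of $e$). The vertex belongs to $R$ if and only if such a sequence exists with $|g_m|/T_m\to 0$. *)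

theory Defs
  imports "HOL-Analysis.Analysis"
begin

section \<open>The billiard table and its trajectories\<close>

text \<open>
  Configurations on the torus are given by their lifts to the plane: every subset of the torus
  below (disks, table, walls) is represented by its full preimage, which is invariant under
  translations by the integer lattice, and a trajectory on the torus by any of its lifts. The lifts
  of a trajectory differ by lattice translations and all notions below are unaffected by them.
\<close>

abbreviation lattice :: "(real \<times> real) set" where
  "lattice \<equiv> \<int> \<times> \<int>"

definition centres :: "nat \<Rightarrow> (real \<times> real) set" where
  "centres n = {(real i / real n, 0) + k | i k. i < n \<and> k \<in> lattice}"

definition table :: "nat \<Rightarrow> real \<Rightarrow> (real \<times> real) set" where
  "table n r = - (\<Union>c\<in>centres n. ball c r)"

definition bdry :: "nat \<Rightarrow> real \<Rightarrow> (real \<times> real) set" where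
  "bdry n r = (\<Union>c\<in>centres n. sphere c r)"

definition reflect :: "real \<times> real \<Rightarrow> real \<times> real \<Rightarrow> real \<times> real \<Rightarrow> real \<times> real" where
  "reflect c p w = w - (2 * (w \<bullet> sgn (p - c))) *\<^sub>R sgn (p - c)"

text \<open>
  \<open>x\<close> is the position and \<open>v\<close> the velocity on the time interval \<open>[0,T]\<close>; at a collision \<open>v\<close> is the
  outgoing velocity. If no collision takes place strictly between the times \<open>s\<close> and \<open>t\<close>, the motion
  between them is free, and \<open>v s\<close> is the incoming velocity at time \<open>t\<close>.
  When the closed disks are disjoint a trajectory collides finitely often in finite time;
  the explicit finiteness condition rules out creeping along the boundary of a disk, where the
  reflection law by itself is void. At a grazing collision the reflection leaves the
  velocity unchanged.
\<close>

definition trajectory ::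
  "nat \<Rightarrow> real \<Rightarrow> real \<Rightarrow> (real \<Rightarrow> real \<times> real) \<Rightarrow> (real \<Rightarrow> real \<times> real) \<Rightarrow> bool" where
  "trajectory n r T x v \<longleftrightarrow>
     0 \<le> T \<and>
     (\<forall>t\<in>{0..T}. x t \<in> table n r \<and> norm (v t) = 1) \<and>
     finite {t \<in> {0..T}. x t \<in> bdry n r} \<and>
     (\<forall>s t. 0 \<le> s \<and> s < t \<and> t \<le> T \<and> (\<forall>u\<in>{s<..<t}. x u \<notin> bdry n r) \<longrightarrow>
        x t = x s + (t - s) *\<^sub>R v s \<and>
        (x t \<notin> bdry n r \<longrightarrow> v t = v s) \<and>
        (\<forall>c\<in>centres n. x t \<in> sphere c r \<longrightarrow> v t = reflect c (x t) (v s)))"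


section \<open>The free group and the wall-crossing word\<close>

datatype gen = Gen_a | Gen_b nat

text \<open>The letter \<open>(g, True)\<close> is the generator \<open>g\<close>, and \<open>(g, False)\<close> is its inverse.\<close>

type_synonym letter = "gen \<times> bool"

definition letters :: "nat \<Rightarrow> letter set" where
  "letters n = insert Gen_a (Gen_b ` {1..n}) \<times> UNIV"

definition letter_inv :: "letter \<Rightarrow> letter" where
  "letter_inv l = (fst l, \<not> snd l)"

text \<open>
  Elements of the free group are represented by reduced words, so that the word length is the
  length of the list.
\<close>

definition reduced :: "letter list \<Rightarrow> bool" where
  "reduced w \<longleftrightarrow> successively (\<lambda>l m. m \<noteq> letter_inv l) w"

definition red_cons :: "letter \<Rightarrow> letter list \<Rightarrow> letter list" where
  "red_cons l w = (case w of [] \<Rightarrow> [l] | m # u \<Rightarrow> if m = letter_inv l then u else l # w)"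

definition free_reduce :: "letter list \<Rightarrow> letter list" where
  "free_reduce w = foldr red_cons w []"

lemma reduced_red_cons: "reduced w \<Longrightarrow> reduced (red_cons l w)"
  by (cases w) (auto simp: reduced_def red_cons_def successively_Cons)

lemma reduced_free_reduce: "reduced (free_reduce w)"
  by (induction w) (auto simp: free_reduce_def reduced_red_cons, simp add: reduced_def)

lemma free_reduce_reduced: "reduced w \<Longrightarrow> free_reduce w = w"
  by (induction w)
    (auto simp: free_reduce_def red_cons_def reduced_def successively_Cons split: list.splits)

lemma free_reduce_cancel: "free_reduce (u @ l # letter_inv l # w) = free_reduce (u @ w)"
proof -
  have "red_cons l (red_cons (letter_inv l) z) = z" if "reduced z" for z
    using that by (cases z)
      (auto simp: reduced_def red_cons_def letter_inv_def successively_Cons prod_eq_iff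
        split: list.splits)
  then show ?thesis
    using reduced_free_reduce[of w] by (simp add: free_reduce_def)
qed

fun wall :: "nat \<Rightarrow> real \<Rightarrow> gen \<Rightarrow> (real \<times> real) set" where
  "wall n r Gen_a = {p + k | p k. p \<in> {0} \<times> {r..1 - r} \<and> k \<in> lattice}"
| "wall n r (Gen_b i) =
     {p + k | p k. p \<in> {(real i - 1) / real n + r..real i / real n - r} \<times> {0} \<and> k \<in> lattice}"

fun transversal :: "gen \<Rightarrow> real \<times> real \<Rightarrow> real" where
  "transversal Gen_a = fst"
| "transversal (Gen_b i) = snd"

definition crosses :: "nat \<Rightarrow> real \<Rightarrow> (real \<Rightarrow> real \<times> real) \<Rightarrow> real \<Rightarrow> letter \<Rightarrow> bool" where
  "crosses n r x t l \<longleftrightarrow>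
     l \<in> letters n \<and> x t \<in> wall n r (fst l) \<and>
     (let h = (\<lambda>s. transversal (fst l) (x s)) in
      if snd l
      then (\<forall>\<^sub>F s in at_left t. h s < h t) \<and> (\<forall>\<^sub>F s in at_right t. h t < h s)
      else (\<forall>\<^sub>F s in at_left t. h t < h s) \<and> (\<forall>\<^sub>F s in at_right t. h s < h t))"

text \<open>
  A trajectory that meets a wall either crosses it there or stays on it forever, bouncing at normal
  incidence between the two disks joined by the wall; the latter contributes no letters. (At an end
  of a wall, on the boundary of a disk, the component of the velocity transversal to the wall is
  preserved by the reflection.) Crossings at the end points of \<open>[0,T]\<close> are not counted; this
  corresponds to one of the possible choices of joining an end point on a wall to the base point.
  For a trajectory, with the closed disks disjoint, the set of crossing times is finite and the
  letter crossed at each of them is unique.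
\<close>

definition crossing_times :: "nat \<Rightarrow> real \<Rightarrow> real \<Rightarrow> (real \<Rightarrow> real \<times> real) \<Rightarrow> real set" where
  "crossing_times n r T x = {t \<in> {0<..<T}. \<exists>l. crosses n r x t l}"

definition crossing_word :: "nat \<Rightarrow> real \<Rightarrow> real \<Rightarrow> (real \<Rightarrow> real \<times> real) \<Rightarrow> letter list" where
  "crossing_word n r T x =
     map (\<lambda>t. THE l. crosses n r x t l) (sorted_list_of_set (crossing_times n r T x))"

definition homotopy_element :: "nat \<Rightarrow> real \<Rightarrow> real \<Rightarrow> (real \<Rightarrow> real \<times> real) \<Rightarrow> letter list" where
  "homotopy_element n r T x = free_reduce (crossing_word n r T x)"


section \<open>The cone over the space of ends and the rotation set\<close>

definition Ends :: "nat \<Rightarrow> (nat \<Rightarrow> letter) set" where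
  "Ends n = {e. (\<forall>i. e i \<in> letters n) \<and> (\<forall>i. e (Suc i) \<noteq> letter_inv (e i))}"

definition converges_to_end :: "(nat \<Rightarrow> letter list) \<Rightarrow> (nat \<Rightarrow> letter) \<Rightarrow> bool" where
  "converges_to_end g e \<longleftrightarrow>
     (\<forall>k. \<forall>\<^sub>F m in sequentially. k \<le> length (g m) \<and> take k (g m) = map e [0..<k])"

definition cone_rel :: "nat \<Rightarrow> ((real \<times> (nat \<Rightarrow> letter)) \<times> (real \<times> (nat \<Rightarrow> letter))) set" where
  "cone_rel n = {(p, q). p \<in> {0..} \<times> Ends n \<and> q \<in> {0..} \<times> Ends n \<and>
     (p = q \<or> fst p = 0 \<and> fst q = 0)}"

definition cone :: "nat \<Rightarrow> (real \<times> (nat \<Rightarrow> letter)) set set" where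
  "cone n = ({0..} \<times> Ends n) // cone_rel n"

definition cone_point :: "nat \<Rightarrow> real \<Rightarrow> (nat \<Rightarrow> letter) \<Rightarrow> (real \<times> (nat \<Rightarrow> letter)) set" where
  "cone_point n s e = cone_rel n `` {(s, e)}"

definition cone_ball :: "nat \<Rightarrow> real \<Rightarrow> (real \<times> (nat \<Rightarrow> letter)) set set" where
  "cone_ball n \<rho> = {cone_point n s e | s e. 0 \<le> s \<and> s \<le> \<rho> \<and> e \<in> Ends n}"

definition rotation_set :: "nat \<Rightarrow> real \<Rightarrow> (real \<times> (nat \<Rightarrow> letter)) set set" where
  "rotation_set n r =
     {cone_point n s e | s e. 0 \<le> s \<and> e \<in> Ends n \<and>
        (\<exists>T x v. (\<forall>m. trajectory n r (T m) (x m) (v m)) \<and>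
           filterlim T at_top sequentially \<and>
           (\<lambda>m. real (length (homotopy_element n r (T m) (x m))) / T m) \<longlonglongrightarrow> s \<and>
           (0 < s \<longrightarrow> converges_to_end (\<lambda>m. homotopy_element n r (T m) (x m)) e))}"

lemma equiv_cone_rel: "equiv ({0..} \<times> Ends n) (cone_rel n)"
  by (auto simp: equiv_def refl_on_def sym_def trans_def cone_rel_def)

lemma rotation_set_subset_cone: "rotation_set n r \<subseteq> cone n"
  by (auto simp: rotation_set_def cone_def cone_point_def intro!: quotientI)

lemma cone_point_in_cone_ball_iff:
  assumes "0 \<le> s" "0 \<le> \<rho>" "e \<in> Ends n"
  shows "cone_point n s e \<in> cone_ball n \<rho> \<longleftrightarrow> s \<le> \<rho>"
proof
  assume "cone_point n s e \<in> cone_ball n \<rho>"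
  then obtain s' e' where *: "0 \<le> s'" "s' \<le> \<rho>" "e' \<in> Ends n"
      "cone_rel n `` {(s, e)} = cone_rel n `` {(s', e')}"
    by (auto simp: cone_ball_def cone_point_def)
  then have "((s, e), (s', e')) \<in> cone_rel n"
    using assms eq_equiv_class_iff[OF equiv_cone_rel, of "(s, e)" n "(s', e')"] by auto
  with * assms show "s \<le> \<rho>"
    by (auto simp: cone_rel_def)
qed (use assms in \<open>auto simp: cone_ball_def\<close>)

end

theory Submission
  imports Defs
begin

text \<open>
  The letters are counted in groups that begin with a \<open>b\<close>-letter. For a trajectory segment of duration
  \<open>T\<close> the argument gives the bound \<open>sqrt 5 * T + 3\<close> on the word length, and \<open>sqrt 5 \<le> 2 * sqrt 2\<close>.

  The walls of the \<open>b\<close>-generators fill the rows \<open>y \<in> \<int>\<close> up to the disks, and the wall of \<open>a\<close> fills the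
  columns \<open>x \<in> \<int>\<close> up to the disks. So a trajectory meets a row or a column only in a wall. There
  it moves with constant transversal velocity, even if it hits a disk at that moment, because the
  centre of that disk lies on the same line and the normal is tangent to the line. Hence it either
  crosses or stays on the line, and between consecutive crossings of rows (or of columns) it remains
  strictly between two neighbouring lines: consecutive crossings with signs \<open>e\<close> and \<open>e'\<close> are
  displaced by \<open>(e + e') / 2\<close> (\<open>consecutive_crossings_displacement\<close>).

  Summed over a block of successive \<open>a\<close>-letters this telescopes: if the horizontal distance between
  the first and the last crossing of the block is \<open>X\<close>, the exponent sum of the block is at most
  \<open>1 + X\<close> in absolute value, and this is the length of the block after reduction. Together with
  the \<open>b\<close>-letter before it, such a block contributes at most \<open>2 + X\<close> to the reduced word.

  It remains to see that the time \<open>\<Delta>\<close> between two consecutive row crossings satisfies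
  \<open>2 + X \<le> sqrt 5 * \<Delta>\<close> (\<open>row_crossing_time\<close>). If both crossings have the same direction, the
  trajectory advances by a whole row, so it travels at least \<open>1\<close> vertically and \<open>X\<close> horizontally,
  and \<open>\<bar>p\<bar> + 2 * \<bar>q\<bar> \<le> sqrt 5 * norm (p, q)\<close>. If it comes back to the row that it has just left,
  it must have turned around at the next row: the disks of the row behind it can only increase its
  vertical speed (\<open>turning_time\<close>). The way there and back takes \<open>2 * (1 - r)\<close>, and for small
  \<open>r\<close> this is so long that \<open>X \<le> \<Delta>\<close> suffices.
\<close>

section \<open>Reduced words\<close>

lemma free_reduce_Nil [simp]: "free_reduce [] = []"
  by (simp add: free_reduce_def)

lemma free_reduce_Cons: "free_reduce (l # w) = red_cons l (free_reduce w)"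
  by (simp add: free_reduce_def)

lemma free_reduce_free_reduce_append: "free_reduce (free_reduce u @ w) = free_reduce (u @ w)"
proof (induction u)
  case (Cons l u)
  have "free_reduce (red_cons l z @ w) = red_cons l (free_reduce (z @ w))" for z
    using free_reduce_cancel[of "[]" l]
    by (cases z) (auto simp: red_cons_def[of l "_ # _"] free_reduce_Cons
        red_cons_def[of l "[]"])
  with Cons show ?case
    by (simp add: free_reduce_Cons)
qed simp

text \<open>
  Reduction of the first factor does not change the product, and each of its letters then adds at
  most one letter to the reduced second factor. This allows a word to be estimated piecewise.
\<close>

lemma length_free_reduce_append:
  "length (free_reduce (u @ w)) \<le> length (free_reduce u) + length (free_reduce w)"
proof -
  have *: "length (free_reduce (z @ w)) \<le> length z + length (free_reduce w)" for z
    by (induction z) (auto simp: free_reduce_Cons red_cons_def split: list.splits)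
  show ?thesis
    using *[of "free_reduce u"] by (simp add: free_reduce_free_reduce_append)
qed

definition letter_sign :: "letter \<Rightarrow> int" where
  "letter_sign l = (if snd l then 1 else - 1)"

lemma free_reduce_power:
  assumes "\<And>l. l \<in> set w \<Longrightarrow> fst l = g"
  shows "free_reduce w =
    (let N = \<Sum>l\<leftarrow>w. letter_sign l in replicate (nat \<bar>N\<bar>) (g, 0 < N))"
  using assms
proof (induction w)
  case (Cons l w)
  define N where "N = (\<Sum>l\<leftarrow>w. letter_sign l)"
  have IH: "free_reduce w = replicate (nat \<bar>N\<bar>) (g, 0 < N)"
    using Cons by (simp add: N_def Let_def)
  obtain b where l: "l = (g, b)"
    using Cons.prems[of l] by (cases l) auto
  consider "N = 0" | k where "N = 1 + int k" | k where "N = - 1 - int k"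
  proof -
    have "N = 0 \<or> N = 1 + int (nat (N - 1)) \<or> N = - 1 - int (nat (- N - 1))"
      by auto
    then show thesis
      using that by blast
  qed
  then have "red_cons l (replicate (nat \<bar>N\<bar>) (g, 0 < N)) =
      replicate (nat \<bar>letter_sign l + N\<bar>) (g, 0 < letter_sign l + N)"
    by cases (auto simp: l red_cons_def letter_sign_def letter_inv_def nat_add_distrib
        split: list.splits)
  then show ?case
    by (simp add: free_reduce_Cons IH N_def[symmetric] Let_def)
qed (simp add: Let_def)

corollary length_free_reduce_power:
  assumes "\<And>l. l \<in> set w \<Longrightarrow> fst l = g"
  shows "int (length (free_reduce w)) = \<bar>\<Sum>l\<leftarrow>w. letter_sign l\<bar>"
  by (simp add: free_reduce_power[OF assms] Let_def)

section \<open>From crossing times to word length\<close>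

lemma successively_sorted_wrt_less:
  fixes ts :: "'a::linorder list"
  assumes "sorted_wrt (<) ts"
  shows "successively (\<lambda>s t. s \<in> set ts \<and> t \<in> set ts \<and> s < t \<and> set ts \<inter> {s<..<t} = {}) ts"
  using assms
proof (induction ts)
  case (Cons t ts)
  then have "successively (\<lambda>s u. s \<in> set ts \<and> u \<in> set ts \<and> s < u \<and> set ts \<inter> {s<..<u} = {}) ts"
    by simp
  then have "successively (\<lambda>s u. s \<in> set (t # ts) \<and> u \<in> set (t # ts) \<and> s < u
      \<and> set (t # ts) \<inter> {s<..<u} = {}) ts"
    by (rule successively_mono) (use Cons.prems in \<open>fastforce\<close>)+
  with Cons.prems show ?case
    by (cases ts) (fastforce simp: successively_Cons)+
qed simp

text \<open>
  With \<open>f\<close> the coordinate and \<open>s\<close> the sign of the crossings of parallel lines, this computes a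
  winding number from the displacement. The error is at most \<open>1\<close>, half a unit from either end.
\<close>

lemma sum_list_telescope:
  fixes f s :: "'a \<Rightarrow> real"
  assumes "successively (\<lambda>a b. f b - f a = (s a + s b) / 2) ts" "ts \<noteq> []"
  shows "sum_list (map s ts) = f (last ts) - f (hd ts) + (s (hd ts) + s (last ts)) / 2"
  using assms
proof (induction ts)
  case (Cons t ts)
  then show ?case
    by (cases ts) (auto simp: successively_Cons field_simps)
qed simp

text \<open>
  Only the exponent sum of a power of \<open>g\<close> survives reduction. In place of the first and the last
  element of \<open>ts\<close> two times in \<open>[a, b]\<close> are obtained, which covers the empty block as well.
\<close>

lemma length_free_reduce_block:
  fixes L :: "real \<Rightarrow> letter" and f :: "real \<Rightarrow> real"
  assumes "\<And>t. t \<in> set ts \<Longrightarrow> fst (L t) = g"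
    and "successively (\<lambda>s t. f t - f s = (letter_sign (L s) + letter_sign (L t)) / 2) ts"
    and sorted: "sorted_wrt (<) ts" "set ts \<subseteq> {a..b}" "a \<le> b"
  obtains u u' where "a \<le> u" "u \<le> u'" "u' \<le> b"
    "length (free_reduce (map L ts)) \<le> 1 + \<bar>f u' - f u\<bar>"
proof (cases "ts = []")
  case False
  have "int (length (free_reduce (map L ts))) = \<bar>\<Sum>l\<leftarrow>map L ts. letter_sign l\<bar>"
    by (rule length_free_reduce_power[where g = g]) (use assms(1) in auto)
  then have "real (length (free_reduce (map L ts))) = \<bar>real_of_int (\<Sum>t\<leftarrow>ts. letter_sign (L t))\<bar>"
    by (simp add: o_def flip: of_int_abs)
  also have "real_of_int (\<Sum>t\<leftarrow>ts. letter_sign (L t)) = (\<Sum>t\<leftarrow>ts. real_of_int (letter_sign (L t)))"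
    by (induction ts) auto
  also have "\<dots> = f (last ts) - f (hd ts) + (letter_sign (L (hd ts)) + letter_sign (L (last ts))) / 2"
    using sum_list_telescope[of f "\<lambda>t. real_of_int (letter_sign (L t))" ts] assms(2) False by simp
  finally have "length (free_reduce (map L ts)) \<le> 1 + \<bar>f (last ts) - f (hd ts)\<bar>"
    by (auto simp: letter_sign_def split: if_splits)
  moreover have "hd ts \<le> last ts"
    using False sorted(1) by (cases ts) (auto simp: less_imp_le)
  moreover have "a \<le> hd ts" "last ts \<le> b"
    using sorted(2) hd_in_set[OF False] last_in_set[OF False] by auto
  ultimately show thesis
    using that by blast
qed (use that[of a a] sorted(3) in simp)

text \<open>
  The time \<open>t0\<close> is that of a letter other than \<open>g\<close>, whose cost is already accounted for. The block
  of powers of \<open>g\<close> after it and the next letter \<open>t1\<close> cost at most \<open>(1 + X) + 1\<close>, which the last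
  hypothesis bounds by \<open>c\<close> times the time elapsed; after \<open>t1\<close> the situation is the same.
  A final block, with no further letter to end it, is paid for by the Lipschitz bound, up to \<open>1\<close>.
\<close>

lemma length_free_reduce_after:
  fixes L :: "real \<Rightarrow> letter" and f :: "real \<Rightarrow> real" and c T :: real
  assumes "1 \<le> c"
    and lip: "\<And>s t. 0 \<le> s \<Longrightarrow> s \<le> t \<Longrightarrow> t \<le> T \<Longrightarrow> \<bar>f t - f s\<bar> \<le> t - s"
    and "sorted_wrt (<) (t0 # ts)" "set (t0 # ts) \<subseteq> {0..T}"
    and "successively (\<lambda>s t. f t - f s = (letter_sign (L s) + letter_sign (L t)) / 2)
           (filter (\<lambda>t. fst (L t) = g) ts)"
    and "successively (\<lambda>s t. \<forall>u u'. s \<le> u \<and> u \<le> u' \<and> u' \<le> t \<longrightarrow> 2 + \<bar>f u' - f u\<bar> \<le> c * (t - s))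
           (t0 # filter (\<lambda>t. fst (L t) \<noteq> g) ts)"
  shows "length (free_reduce (map L ts)) \<le> c * (T - t0) + 1"
  using assms(3-)
proof (induction ts arbitrary: t0 rule: length_induct)
  case (1 ts)
  define A where "A = takeWhile (\<lambda>t. fst (L t) = g) ts"
  define B where "B = dropWhile (\<lambda>t. fst (L t) = g) ts"
  have ts: "ts = A @ B"
    by (simp add: A_def B_def)
  have A: "\<And>t. t \<in> set A \<Longrightarrow> fst (L t) = g"
    by (auto simp: A_def dest: set_takeWhileD)
  have fA: "filter (\<lambda>t. fst (L t) = g) A = A" "filter (\<lambda>t. fst (L t) \<noteq> g) A = []"
    using A by (auto simp: filter_id_conv filter_empty_conv)
  have sA: "successively (\<lambda>s t. f t - f s = (letter_sign (L s) + letter_sign (L t)) / 2) A"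
    using "1.prems"(3) by (simp add: ts fA successively_append_iff)
  show ?case
  proof (cases B)
    case Nil
    obtain u u' where u: "t0 \<le> u" "u \<le> u'" "u' \<le> T"
        "length (free_reduce (map L A)) \<le> 1 + \<bar>f u' - f u\<bar>"
      by (rule length_free_reduce_block[OF A sA, where a = t0 and b = T])
         (use "1.prems"(1,2) in \<open>auto simp: ts sorted_wrt_append less_imp_le\<close>)
    have "\<bar>f u' - f u\<bar> \<le> 1 * (T - t0)"
      using lip[of u u'] u "1.prems"(2) by simp
    also have "\<dots> \<le> c * (T - t0)"
      using \<open>1 \<le> c\<close> "1.prems"(2) by (intro mult_right_mono) auto
    finally show ?thesis
      using u(4) by (simp add: ts Nil)
  next
    case (Cons t1 C)
    have t1: "fst (L t1) \<noteq> g"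
      using Cons hd_dropWhile[of "\<lambda>t. fst (L t) = g" ts] by (simp add: B_def)
    obtain u u' where u: "t0 \<le> u" "u \<le> u'" "u' \<le> t1"
        "length (free_reduce (map L A)) \<le> 1 + \<bar>f u' - f u\<bar>"
      by (rule length_free_reduce_block[OF A sA, where a = t0 and b = t1])
         (use "1.prems"(1) in \<open>auto simp: ts Cons sorted_wrt_append less_imp_le\<close>)
    have "length (free_reduce (map L C)) \<le> c * (T - t1) + 1"
      by (rule "1.IH"[rule_format])
         (use "1.prems" t1 in \<open>auto simp: ts fA Cons sorted_wrt_append successively_append_iff
            successively_Cons\<close>)
    moreover have "2 + \<bar>f u' - f u\<bar> \<le> c * (t1 - t0)"
      using "1.prems"(4) t1 u by (simp add: ts fA Cons)
    moreover have "length (free_reduce (map L ts)) \<le>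
        length (free_reduce (map L A)) + (1 + length (free_reduce (map L C)))"
      using length_free_reduce_append[of "map L A" "map L (t1 # C)"]
        length_free_reduce_append[of "[L t1]" "map L C"]
      by (simp add: ts Cons free_reduce_Cons[of _ "[]"] red_cons_def[of _ "[]"])
    ultimately show ?thesis
      using u(4) by (simp add: algebra_simps)
  qed
qed

text \<open>
  Besides the \<open>1\<close> lost in the final block, \<open>1\<close> is lost in the block before the first letter other
  than \<open>g\<close>, and \<open>1\<close> for that letter itself.
\<close>

proposition length_free_reduce_le:
  fixes L :: "real \<Rightarrow> letter" and f :: "real \<Rightarrow> real" and c T :: real
  assumes "1 \<le> c" "0 \<le> T"
    and lip: "\<And>s t. 0 \<le> s \<Longrightarrow> s \<le> t \<Longrightarrow> t \<le> T \<Longrightarrow> \<bar>f t - f s\<bar> \<le> t - s"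
    and sorted: "sorted_wrt (<) ts" "set ts \<subseteq> {0..T}"
    and g: "successively (\<lambda>s t. f t - f s = (letter_sign (L s) + letter_sign (L t)) / 2)
           (filter (\<lambda>t. fst (L t) = g) ts)"
    and not_g: "successively
           (\<lambda>s t. \<forall>u u'. s \<le> u \<and> u \<le> u' \<and> u' \<le> t \<longrightarrow> 2 + \<bar>f u' - f u\<bar> \<le> c * (t - s))
           (filter (\<lambda>t. fst (L t) \<noteq> g) ts)"
  shows "length (free_reduce (map L ts)) \<le> c * T + 3"
proof -
  define A where "A = takeWhile (\<lambda>t. fst (L t) = g) ts"
  define B where "B = dropWhile (\<lambda>t. fst (L t) = g) ts"
  have ts: "ts = A @ B"
    by (simp add: A_def B_def)
  have A: "\<And>t. t \<in> set A \<Longrightarrow> fst (L t) = g"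
    by (auto simp: A_def dest: set_takeWhileD)
  have fA: "filter (\<lambda>t. fst (L t) = g) A = A" "filter (\<lambda>t. fst (L t) \<noteq> g) A = []"
    using A by (auto simp: filter_id_conv filter_empty_conv)
  have sA: "successively (\<lambda>s t. f t - f s = (letter_sign (L s) + letter_sign (L t)) / 2) A"
    using g by (simp add: ts fA successively_append_iff)
  show ?thesis
  proof (cases B)
    case Nil
    obtain u u' where u: "0 \<le> u" "u \<le> u'" "u' \<le> T"
        "length (free_reduce (map L A)) \<le> 1 + \<bar>f u' - f u\<bar>"
      by (rule length_free_reduce_block[OF A sA, where a = 0 and b = T])
         (use sorted \<open>0 \<le> T\<close> in \<open>auto simp: ts sorted_wrt_append\<close>)
    have "\<bar>f u' - f u\<bar> \<le> 1 * T"
      using lip[of u u'] u by simp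
    also have "\<dots> \<le> c * T"
      using \<open>1 \<le> c\<close> \<open>0 \<le> T\<close> by (intro mult_right_mono) auto
    finally show ?thesis
      using u(4) by (simp add: ts Nil)
  next
    case (Cons t1 C)
    have t1: "fst (L t1) \<noteq> g"
      using Cons hd_dropWhile[of "\<lambda>t. fst (L t) = g" ts] by (simp add: B_def)
    have T: "0 \<le> t1" "t1 \<le> T"
      using sorted(2) by (auto simp: ts Cons)
    obtain u u' where u: "0 \<le> u" "u \<le> u'" "u' \<le> t1"
        "length (free_reduce (map L A)) \<le> 1 + \<bar>f u' - f u\<bar>"
      by (rule length_free_reduce_block[OF A sA, where a = 0 and b = t1])
         (use sorted in \<open>auto simp: ts Cons sorted_wrt_append less_imp_le\<close>)
    have "\<bar>f u' - f u\<bar> \<le> 1 * t1"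
      using lip[of u u'] u T by simp
    also have "\<dots> \<le> c * t1"
      using \<open>1 \<le> c\<close> T by (intro mult_right_mono) auto
    finally have "\<bar>f u' - f u\<bar> \<le> c * t1" .
    moreover have "length (free_reduce (map L C)) \<le> c * (T - t1) + 1"
    proof (rule length_free_reduce_after[where f = f and g = g, OF \<open>1 \<le> c\<close> lip])
      show "sorted_wrt (<) (t1 # C)" "set (t1 # C) \<subseteq> {0..T}"
        using sorted by (auto simp: ts Cons sorted_wrt_append)
      show "successively (\<lambda>s t. f t - f s = (letter_sign (L s) + letter_sign (L t)) / 2)
          (filter (\<lambda>t. fst (L t) = g) C)"
        using g t1 by (simp add: ts Cons successively_append_iff)
      show "successively
          (\<lambda>s t. \<forall>u u'. s \<le> u \<and> u \<le> u' \<and> u' \<le> t \<longrightarrow> 2 + \<bar>f u' - f u\<bar> \<le> c * (t - s))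
          (t1 # filter (\<lambda>t. fst (L t) \<noteq> g) C)"
        using not_g t1 by (simp add: ts Cons fA)
    qed
    moreover have "length (free_reduce (map L ts)) \<le>
        length (free_reduce (map L A)) + (1 + length (free_reduce (map L C)))"
      using length_free_reduce_append[of "map L A" "map L (t1 # C)"]
        length_free_reduce_append[of "[L t1]" "map L C"]
      by (simp add: ts Cons free_reduce_Cons[of _ "[]"] red_cons_def[of _ "[]"])
    ultimately show ?thesis
      using u(4) by (simp add: algebra_simps)
  qed
qed

section \<open>Disks and walls\<close>

lemma centres_iff:
  assumes "1 \<le> n"
  shows "c \<in> centres n \<longleftrightarrow> (\<exists>q k :: int. c = (of_int q / real n, of_int k))"
proof
  assume "c \<in> centres n"
  then obtain i a b :: int where "c = (of_int i / real n + of_int a, of_int b)"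
    by (auto simp: centres_def elim!: Ints_cases) (metis of_int_of_nat_eq)
  then have "c = (of_int (i + a * int n) / real n, of_int b)"
    using assms by (simp add: field_simps)
  then show "\<exists>q k :: int. c = (of_int q / real n, of_int k)"
    by blast
next
  assume "\<exists>q k :: int. c = (of_int q / real n, of_int k)"
  then obtain q k :: int where c: "c = (of_int q / real n, of_int k)"
    by blast
  define i where "i = nat (q mod int n)"
  have i: "int i = q mod int n" "i < n"
    using assms by (auto simp: i_def nat_less_iff)
  have "real_of_int q = real n * of_int (q div int n) + real i"
    using i(1) by (metis mult_div_mod_eq of_int_add of_int_mult of_int_of_nat_eq)
  then have "c = (real i / real n, 0) + (of_int (q div int n), of_int k)"
    using assms by (simp add: c field_simps)
  then show "c \<in> centres n"
    using i(2) unfolding centres_def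
    by (intro CollectI exI[of _ i] exI[of _ "(of_int (q div int n), of_int k)"] conjI) auto
qed

lemma snd_centre_Ints: "1 \<le> n \<Longrightarrow> c \<in> centres n \<Longrightarrow> snd c \<in> \<int>"
  by (auto simp: centres_iff)

lemma transversal_cases: "transversal g = fst \<or> transversal g = snd"
  by (cases g) auto

text \<open>
  The coordinates of the centres are multiples of \<open>1 / n\<close> and of \<open>1\<close>, both larger than \<open>r\<close>, so a
  disk met on the line \<open>x = k\<close> or \<open>y = k\<close> is centred on this line.
\<close>

lemma transversal_centre_eq:
  assumes "1 \<le> n" "r < 1 / real n" "r < 1"
    and "c \<in> centres n" "p \<in> sphere c r" "transversal g p \<in> \<int>"
  shows "transversal g c = transversal g p"
proof -
  obtain q k :: int where c: "c = (of_int q / real n, of_int k)"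
    using assms by (auto simp: centres_iff)
  have d: "\<bar>fst p - fst c\<bar> \<le> r" "\<bar>snd p - snd c\<bar> \<le> r"
    using assms(5) dist_fst_le[of p c] dist_snd_le[of p c]
    by (simp_all add: dist_real_def dist_commute)
  show ?thesis
  proof (cases "transversal g = fst")
    case True
    then obtain m where m: "fst p = of_int m"
      using assms(6) by (auto elim: Ints_cases)
    have "real_of_int (m * int n - q) = real n * (fst p - fst c)"
      using assms(1) by (simp add: c m field_simps)
    then have "\<bar>real_of_int (m * int n - q)\<bar> = real n * \<bar>fst p - fst c\<bar>"
      by (simp only: abs_mult abs_of_nat)
    also have "\<dots> < real n * (1 / real n)"
      using d assms(1,2) by (intro mult_strict_left_mono) auto
    finally have "\<bar>real_of_int (m * int n - q)\<bar> < 1"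
      using assms(1) by (simp del: of_int_diff of_int_mult)
    then have "\<bar>m * int n - q\<bar> < 1"
      by linarith
    then have "q = m * int n"
      by simp
    then show ?thesis
      using assms(1) by (simp add: True c m)
  next
    case False
    then have s: "transversal g = snd"
      using transversal_cases by blast
    then obtain m where m: "snd p = of_int m"
      using assms(6) by (auto elim: Ints_cases)
    have "\<bar>real_of_int (m - k)\<bar> < 1"
      using d assms(3) by (simp add: c m)
    then show ?thesis
      by (simp add: s c m)
  qed
qed

lemma snd_wall_Gen_b: "p \<in> wall n r (Gen_b i) \<Longrightarrow> snd p \<in> \<int>"
  by auto

lemma transversal_wall_Ints: "p \<in> wall n r g \<Longrightarrow> transversal g p \<in> \<int>"
  by (cases g) auto

lemma snd_wall_Gen_a:
  assumes "p \<in> wall n r Gen_a" "0 < r"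
  shows "snd p \<notin> \<int>"
proof
  assume "snd p \<in> \<int>"
  moreover obtain y and k :: int where "snd p = y + of_int k" "r \<le> y" "y \<le> 1 - r"
    using assms by (auto elim!: Ints_cases)
  ultimately have "y \<in> \<int>" "0 < y" "y < 1"
    using assms(2) by (metis Ints_diff Ints_of_int add_diff_cancel_right', linarith+)
  then show False
    by (auto elim!: Ints_cases)
qed

text \<open>
  The wall stays at the distance \<open>r\<close> from the two ends of the interval between the centres, so the
  integral part of \<open>n\<close> times the abscissa determines the index.
\<close>

lemma floor_wall_Gen_b:
  assumes "1 \<le> n" "0 < r" "p \<in> wall n r (Gen_b i)" "i \<in> {1..n}"
  shows "int i = \<lfloor>real n * fst p\<rfloor> mod int n + 1"
proof -
  obtain z and k :: int where z: "fst p = z + of_int k"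
      "(real i - 1) / real n + r \<le> z" "z \<le> real i / real n - r"
    using assms by (auto elim!: Ints_cases)
  have "(real i - 1) / real n < z" "z < real i / real n"
    using z assms(2) by auto
  then have "real i - 1 < real n * z" "real n * z < real i"
    using assms(1) by (auto simp: field_simps)
  then have "\<lfloor>real n * fst p\<rfloor> = int i - 1 + int n * k"
    using assms(4) by (intro floor_unique) (auto simp: z algebra_simps)
  then show ?thesis
    using assms(4) by simp
qed

lemma wall_unique:
  assumes "1 \<le> n" "0 < r" "p \<in> wall n r g" "p \<in> wall n r g'"
    and "(g, b) \<in> letters n" "(g', b') \<in> letters n"
  shows "g = g'"
proof (cases g; cases g')
  fix i j
  assume "g = Gen_b i" "g' = Gen_b j"
  moreover from this have "i \<in> {1..n}" "j \<in> {1..n}"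
    using assms by (auto simp: letters_def)
  ultimately show ?thesis
    using floor_wall_Gen_b[of n r p i] floor_wall_Gen_b[of n r p j] assms(1-4)
    by (metis add_right_imp_eq of_nat_eq_iff)
qed (use assms snd_wall_Gen_a snd_wall_Gen_b in metis)+

text \<open>
  On a row or column, the disks cover everything outside the walls: the point has distance at least
  \<open>r\<close> from the two neighbouring centres on the line.
\<close>

lemma exists_wall:
  assumes "1 \<le> n" "p \<in> table n r" "transversal g p \<in> \<int>"
  obtains g' where "transversal g' = transversal g" "p \<in> wall n r g'" "\<And>b. (g', b) \<in> letters n"
proof (cases "transversal g = fst")
  case True
  then obtain m :: int where m: "fst p = of_int m"
    using assms(3) by (auto elim: Ints_cases)
  define k where "k = \<lfloor>snd p\<rfloor>"
  have k: "of_int k \<le> snd p" "snd p < of_int k + 1"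
    unfolding k_def by linarith+
  have far: "r \<le> \<bar>snd p - of_int j\<bar>" for j :: int
  proof -
    have "(of_int m, of_int j) \<in> centres n"
      using assms(1) unfolding centres_iff[OF assms(1)]
      by (intro exI[of _ "m * int n"] exI[of _ j]) simp
    then have "r \<le> dist (of_int m, of_int j) p"
      using assms(2) by (auto simp: table_def not_less)
    then show ?thesis
      by (cases p) (use m in \<open>simp add: dist_Pair_Pair dist_real_def\<close>)
  qed
  have "r \<le> snd p - of_int k" "snd p - of_int k \<le> 1 - r"
    using far[of k] far[of "k + 1"] k by simp_all
  then have "p \<in> wall n r Gen_a"
    unfolding wall.simps
    by (intro CollectI exI[of _ "(0, snd p - of_int k)"] exI[of _ "(of_int m, of_int k)"])
       (use m in \<open>auto simp: prod_eq_iff\<close>)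
  then show ?thesis
    using that[of Gen_a] True by (auto simp: letters_def)
next
  case False
  then have s: "transversal g = snd"
    using transversal_cases by blast
  then obtain m :: int where m: "snd p = of_int m"
    using assms(3) by (auto elim: Ints_cases)
  define q where "q = \<lfloor>real n * fst p\<rfloor>"
  have "of_int q \<le> real n * fst p" "real n * fst p < of_int q + 1"
    unfolding q_def by linarith+
  then have q: "of_int q / real n \<le> fst p" "fst p < (of_int q + 1) / real n"
    using assms(1) by (simp_all add: field_simps)
  have far: "r \<le> \<bar>fst p - of_int j / real n\<bar>" for j :: int
  proof -
    have "(of_int j / real n, of_int m) \<in> centres n"
      using assms(1) by (auto simp: centres_iff)
    then have "r \<le> dist (of_int j / real n, of_int m) p"
      using assms(2) by (auto simp: table_def not_less)
    then show ?thesis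
      by (cases p) (use m in \<open>simp add: dist_Pair_Pair dist_real_def\<close>)
  qed
  have far': "r \<le> fst p - of_int q / real n" "fst p \<le> (of_int q + 1) / real n - r"
    using far[of q] far[of "q + 1"] q by simp_all
  define i where "i = nat (q mod int n) + 1"
  have i: "int i = q mod int n + 1" "i \<in> {1..n}"
    using assms(1) pos_mod_bound[of "int n" q] pos_mod_sign[of "int n" q]
    by (auto simp: i_def simp del: pos_mod_bound pos_mod_sign)
  have "q = int n * (q div int n) + (int i - 1)"
    by (simp add: i(1))
  then have "real_of_int q = of_int (int n * (q div int n) + (int i - 1))"
    by (rule arg_cong)
  then have "real_of_int q = real n * of_int (q div int n) + (real i - 1)"
    by (simp only: of_int_add of_int_mult of_int_diff of_int_of_nat_eq of_int_1)
  then have "of_int q / real n = of_int (q div int n) + (real i - 1) / real n"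
      "(of_int q + 1) / real n = of_int (q div int n) + real i / real n"
    using assms(1) by (simp_all add: field_simps)
  with far' have "p \<in> wall n r (Gen_b i)"
    unfolding wall.simps
    by (intro CollectI exI[of _ "(fst p - of_int (q div int n), 0)"]
        exI[of _ "(of_int (q div int n), of_int m)"])
       (use m in \<open>auto simp: prod_eq_iff\<close>)
  then show ?thesis
    using that[of "Gen_b i"] s i(2) by (auto simp: letters_def)
qed

section \<open>Trajectories\<close>

lemma transversal_simps:
  "transversal g (p + q) = transversal g p + transversal g q"
  "transversal g (p - q) = transversal g p - transversal g q"
  "transversal g (a *\<^sub>R p) = a * transversal g p"
  using transversal_cases[of g] by auto

lemma transversal_le_norm: "\<bar>transversal g p\<bar> \<le> norm p"
  using transversal_cases[of g] dist_fst_le[of p 0] dist_snd_le[of p 0] by auto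

text \<open>
  By the bound \<open>1 / n\<close> a disk does not reach the next vertical line of centres. The bound \<open>1 / 10\<close>
  makes the time \<open>2 * (1 - r)\<close> for turning around at least \<open>9 / 5\<close>, which is what the estimate
  \<open>2 \<le> (sqrt 5 - 1) * \<Delta>\<close> of a return asks for.
\<close>

locale billiard_trajectory =
  fixes n :: nat and r T :: real and x v :: "real \<Rightarrow> real \<times> real"
  assumes n: "1 \<le> n" and r: "0 < r" "r < 1 / real n" "r < 1 / 10"
    and trajectory: "trajectory n r T x v"
begin

lemma T_nonneg: "0 \<le> T"
  using trajectory by (simp add: trajectory_def)

lemma in_table: "t \<in> {0..T} \<Longrightarrow> x t \<in> table n r"
  and norm_velocity: "t \<in> {0..T} \<Longrightarrow> norm (v t) = 1"
  using trajectory by (auto simp: trajectory_def)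

lemma finite_collisions: "finite {t \<in> {0..T}. x t \<in> bdry n r}"
  using trajectory by (simp add: trajectory_def)

definition free_between :: "real \<Rightarrow> real \<Rightarrow> bool" where
  "free_between s t \<longleftrightarrow> 0 \<le> s \<and> s < t \<and> t \<le> T \<and> (\<forall>u\<in>{s<..<t}. x u \<notin> bdry n r)"

lemma free_betweenD:
  assumes "free_between s t"
  shows "x t = x s + (t - s) *\<^sub>R v s"
    and "x t \<notin> bdry n r \<Longrightarrow> v t = v s"
    and "c \<in> centres n \<Longrightarrow> x t \<in> sphere c r \<Longrightarrow> v t = reflect c (x t) (v s)"
  using assms trajectory by (auto simp: trajectory_def free_between_def)

lemma free_between_subinterval:
  "free_between s t \<Longrightarrow> s \<le> s' \<Longrightarrow> s' < t' \<Longrightarrow> t' \<le> t \<Longrightarrow> free_between s' t'"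
  by (auto simp: free_between_def)

text \<open>
  Induction along the collisions, of which there are finitely many: what every free flight preserves,
  including the reflection at its end, holds all along the trajectory.
\<close>

lemma free_flight_induct [consumes 3, case_names start flight]:
  assumes "0 \<le> s" "s \<le> t" "t \<le> T"
    and start: "P s"
    and flight: "\<And>s' t'. s \<le> s' \<Longrightarrow> t' \<le> t \<Longrightarrow> free_between s' t' \<Longrightarrow> P s' \<Longrightarrow> P t'"
  shows "P t"
  using assms
proof (induction "card {u \<in> {s<..<t}. x u \<in> bdry n r}" arbitrary: t rule: less_induct)
  case less
  define K where "K = {u \<in> {s<..<t}. x u \<in> bdry n r}"
  have K: "finite K"
    by (rule finite_subset[OF _ finite_collisions]) (use less.prems in \<open>auto simp: K_def\<close>)
  show ?case
  proof (cases "s = t \<or> K = {}")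
    case True
    then have "s = t \<or> free_between s t"
      using less.prems(1-3) by (auto simp: K_def free_between_def)
    then show ?thesis
      using less.prems(4,5) by blast
  next
    case False
    define k where "k = Max K"
    have k: "k \<in> K"
      using K False Max_in by (simp add: k_def)
    have "{u \<in> {s<..<k}. x u \<in> bdry n r} \<subset> K"
      using k by (auto simp: K_def)
    then have "card {u \<in> {s<..<k}. x u \<in> bdry n r} < card K"
      using K by (rule psubset_card_mono[rotated])
    then have "P k"
      by (rule less.hyps[folded K_def]) (use k less.prems in \<open>auto simp: K_def\<close>)
    moreover have "free_between k t"
      unfolding free_between_def
    proof (intro conjI ballI notI)
      fix u
      assume u: "u \<in> {k<..<t}" "x u \<in> bdry n r"
      then have "u \<in> K"
        using k by (auto simp: K_def)
      then show False
        using Max_ge[OF K, of u] u by (simp add: k_def)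
    qed (use k less.prems in \<open>auto simp: K_def\<close>)
    ultimately show ?thesis
      using less.prems(5)[of k t] k by (auto simp: K_def)
  qed
qed

lemma displacement_le:
  assumes "0 \<le> s" "s \<le> t" "t \<le> T"
  shows "norm (x t - x s) \<le> t - s"
  using assms
proof (induction rule: free_flight_induct)
  case (flight s' t')
  then have s't': "0 \<le> s'" "s' < t'" "t' \<le> T"
    by (auto simp: free_between_def)
  have "norm (x t' - x s) \<le> norm (x s' - x s) + norm ((t' - s') *\<^sub>R v s')"
    unfolding free_betweenD(1)[OF flight(3)] by (metis add.commute add_diff_eq norm_triangle_ineq)
  also have "norm ((t' - s') *\<^sub>R v s') = t' - s'"
    using s't' norm_velocity[of s'] by simp
  finally show ?case
    using flight(4) by simp
qed simp

lemma transversal_displacement_le: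
  assumes "0 \<le> s" "s \<le> t" "t \<le> T"
  shows "\<bar>transversal g (x t) - transversal g (x s)\<bar> \<le> t - s"
  using displacement_le[OF assms] transversal_le_norm[of g "x t - x s"]
  by (simp add: transversal_simps)

lemma continuous_on_transversal: "continuous_on {0..T} (\<lambda>t. transversal g (x t))"
proof -
  have "1-lipschitz_on {0..T} (\<lambda>t. transversal g (x t))"
  proof (rule lipschitz_onI)
    fix s t assume "s \<in> {0..T}" "t \<in> {0..T}"
    then show "dist (transversal g (x s)) (transversal g (x t)) \<le> 1 * dist s t"
      using transversal_displacement_le[of s t g] transversal_displacement_le[of t s g]
      by (cases "s \<le> t") (auto simp: dist_real_def)
  qed simp
  then show ?thesis
    by (rule lipschitz_on_continuous_on)
qed

text \<open>
  Just before the collision the point was outside the disk.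
\<close>

lemma incoming_velocity:
  assumes "free_between s t" "c \<in> centres n" "x t \<in> sphere c r"
  shows "v s \<bullet> (x t - c) \<le> 0"
proof (rule ccontr)
  assume "\<not> v s \<bullet> (x t - c) \<le> 0"
  then have pos: "0 < v s \<bullet> (x t - c)"
    by simp
  have st: "0 \<le> s" "s < t" "t \<le> T"
    using assms(1) by (auto simp: free_between_def)
  \<comment> \<open>Moving back for a time \<open>d\<close> would change the squared distance to \<open>c\<close> by \<open>d\<^sup>2 - 2 * d * (v s \<bullet> (x t - c))\<close>.\<close>
  define d where "d = min ((t - s) / 2) (v s \<bullet> (x t - c))"
  have "d \<le> (t - s) / 2"
    unfolding d_def by (rule min.cobounded1)
  with pos st have d: "0 < d" "d < t - s" "d \<le> v s \<bullet> (x t - c)"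
    by (auto simp: d_def)
  have "x (t - d) = x s + (t - d - s) *\<^sub>R v s"
    by (rule free_betweenD(1)[OF free_between_subinterval[OF assms(1)]]) (use d in auto)
  then have p: "x (t - d) - c = (x t - c) - d *\<^sub>R v s"
    by (simp add: free_betweenD(1)[OF assms(1)] algebra_simps)
  have "x (t - d) \<in> table n r"
    by (rule in_table) (use d st in auto)
  then have "r \<le> norm (x (t - d) - c)"
    using assms(2) by (auto simp: table_def not_less dist_norm norm_minus_commute)
  then have "r\<^sup>2 \<le> (norm (x (t - d) - c))\<^sup>2"
    using r by (intro power_mono) auto
  also have "\<dots> = (norm (x t - c))\<^sup>2 - 2 * d * (v s \<bullet> (x t - c)) + d\<^sup>2 * (norm (v s))\<^sup>2"
    unfolding p power2_norm_eq_inner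
    by (simp add: inner_diff_left inner_diff_right inner_commute power2_eq_square algebra_simps)
  also have "norm (x t - c) = r"
    using assms(3) by (simp add: dist_norm norm_minus_commute)
  also have "norm (v s) = 1"
    using norm_velocity[of s] st by simp
  finally have "d * (2 * (v s \<bullet> (x t - c))) \<le> d * d"
    by (simp add: power2_eq_square algebra_simps)
  then have "2 * (v s \<bullet> (x t - c)) \<le> d"
    using d(1) by simp
  then show False
    using d(3) pos by simp
qed

text \<open>
  At a collision on the line \<open>x = k\<close> or \<open>y = k\<close> the normal is parallel to the line.
\<close>

lemma transversal_velocity_eq:
  assumes "free_between s t" "transversal g (x t) \<in> \<int>"
  shows "transversal g (v t) = transversal g (v s)"
proof (cases "x t \<in> bdry n r")
  case True
  then obtain c where c: "c \<in> centres n" "x t \<in> sphere c r"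
    by (auto simp: bdry_def)
  have "transversal g (x t - c) = 0"
    using transversal_centre_eq[OF n r(2) _ c assms(2)] r(3) by (simp add: transversal_simps)
  then show ?thesis
    unfolding free_betweenD(3)[OF assms(1) c] reflect_def
    by (simp add: transversal_simps sgn_div_norm)
qed (use free_betweenD(2)[OF assms(1)] in simp)

lemma locally_linear:
  assumes "0 < t" "t < T" "transversal g (x t) \<in> \<int>"
  shows "\<forall>\<^sub>F s in nhds t.
    transversal g (x s) = transversal g (x t) + (s - t) * transversal g (v t)"
proof -
  define K where "K = {u \<in> {0..T}. x u \<in> bdry n r} - {t}"
  have "open ({0<..<T} - K)"
    using finite_collisions by (intro open_Diff finite_imp_closed) (auto simp: K_def)
  moreover have "t \<in> {0<..<T} - K"
    using assms by (auto simp: K_def)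
  ultimately obtain e where e: "e > 0" "cball t e \<subseteq> {0<..<T} - K"
    using open_contains_cball by blast
  have "0 < t - e" "t + e < T"
    using e subsetD[OF e(2), of "t - e"] subsetD[OF e(2), of "t + e"] by (auto simp: dist_real_def)
  moreover have "x u \<notin> bdry n r" if "u \<in> {t - e<..<t + e} - {t}" for u
  proof -
    have "u \<in> cball t e"
      using that by (auto simp: dist_real_def)
    then show ?thesis
      using that e(2) by (auto simp: K_def)
  qed
  ultimately have free: "free_between (t - e) t" "free_between t (t + e)"
    using e(1) by (auto simp: free_between_def)
  have "transversal g (x s) = transversal g (x t) + (s - t) * transversal g (v t)"
    if s: "s \<in> {t - e<..<t + e}" for s
  proof (cases s t rule: linorder_cases)
    case less
    have "x s = x (t - e) + (s - (t - e)) *\<^sub>R v (t - e)"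
      by (rule free_betweenD(1)[OF free_between_subinterval[OF free(1)]]) (use s less in auto)
    then have "x s = x t + (s - t) *\<^sub>R v (t - e)"
      using free_betweenD(1)[OF free(1)] by (simp add: algebra_simps)
    then show ?thesis
      using transversal_velocity_eq[OF free(1) assms(3)] by (simp add: transversal_simps)
  next
    case greater
    have "x s = x t + (s - t) *\<^sub>R v t"
      by (rule free_betweenD(1)[OF free_between_subinterval[OF free(2)]]) (use s greater in auto)
    then show ?thesis
      by (simp add: transversal_simps)
  qed simp
  moreover have "\<forall>\<^sub>F s in nhds t. s \<in> {t - e<..<t + e}"
    by (rule eventually_nhds_in_open) (use e(1) in auto)
  ultimately show ?thesis
    by (rule eventually_mono[rotated])
qed

subsection \<open>Wall crossings\<close>

lemma crosses_wall: "crosses n r x t l \<Longrightarrow> x t \<in> wall n r (fst l) \<and> l \<in> letters n"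
  by (simp add: crosses_def)

lemma crosses_transversal_Ints:
  "crosses n r x t l \<Longrightarrow> transversal (fst l) (x t) \<in> \<int>"
  using crosses_wall transversal_wall_Ints by blast

lemma crosses_velocity:
  assumes "crosses n r x t l" "0 < t" "t < T"
  shows "0 < letter_sign l * transversal (fst l) (v t)"
proof -
  define w where "w = transversal (fst l) (v t)"
  have "\<forall>\<^sub>F s in nhds t. transversal (fst l) (x s) = transversal (fst l) (x t) + (s - t) * w"
    using locally_linear[OF assms(2,3) crosses_transversal_Ints[OF assms(1)]] by (simp add: w_def)
  then have lin: "\<forall>\<^sub>F s in at_right t. transversal (fst l) (x s) = transversal (fst l) (x t) + (s - t) * w"
    by (auto simp: eventually_at_filter elim: eventually_mono)
  have gt: "\<forall>\<^sub>F s in at_right t. t < s"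
    by (auto simp: eventually_at_filter)
  show ?thesis
  proof (cases "snd l")
    case True
    then have "\<forall>\<^sub>F s in at_right t. transversal (fst l) (x t) < transversal (fst l) (x s)"
      using assms(1) by (simp add: crosses_def Let_def)
    with lin gt have "\<forall>\<^sub>F s in at_right t. 0 < w"
      by eventually_elim (auto simp: zero_less_mult_iff)
    then show ?thesis
      using True by (simp add: letter_sign_def w_def)
  next
    case False
    then have "\<forall>\<^sub>F s in at_right t. transversal (fst l) (x s) < transversal (fst l) (x t)"
      using assms(1) by (simp add: crosses_def Let_def)
    with lin gt have "\<forall>\<^sub>F s in at_right t. w < 0"
      by eventually_elim (auto simp: mult_less_0_iff)
    then show ?thesis
      using False by (simp add: letter_sign_def w_def)
  qed
qed

text \<open>
  By local linearity the only way to meet a row or column without crossing it is to have no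
  transversal velocity, that is, to stay on it for a while.
\<close>

lemma exists_crosses:
  assumes "0 < t" "t < T" "transversal g (x t) \<in> \<int>" "transversal g (v t) \<noteq> 0"
  obtains l where "crosses n r x t l" "transversal (fst l) = transversal g"
proof -
  obtain g' where g': "transversal g' = transversal g" "x t \<in> wall n r g'" "\<And>b. (g', b) \<in> letters n"
    using exists_wall[OF n in_table assms(3)] assms(1,2) by auto
  define w where "w = transversal g (v t)"
  have lin: "\<forall>\<^sub>F s in nhds t. transversal g (x s) = transversal g (x t) + (s - t) * w"
    using locally_linear[OF assms(1-3)] by (simp add: w_def)
  have "0 < w * w"
    using assms(4) by (simp add: w_def zero_less_mult_iff linorder_neq_iff disj_commute)
  then have sgn: "0 < w * (d * w)" if "0 < d" for d
    using that by (simp add: mult.left_commute)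
  have "\<forall>\<^sub>F s in at_left t. 0 < w * (transversal g (x t) - transversal g (x s))"
    using lin unfolding eventually_at_filter
  proof eventually_elim
    case (elim s)
    then have "transversal g (x t) - transversal g (x s) = (t - s) * w"
      by (simp add: algebra_simps)
    then show ?case
      using sgn[of "t - s"] by simp
  qed
  moreover have "\<forall>\<^sub>F s in at_right t. 0 < w * (transversal g (x s) - transversal g (x t))"
    using lin unfolding eventually_at_filter
  proof eventually_elim
    case (elim s)
    then have "transversal g (x s) - transversal g (x t) = (s - t) * w"
      by (simp add: algebra_simps)
    then show ?case
      using sgn[of "s - t"] by simp
  qed
  moreover have "0 < w \<or> w < 0"
    using assms(4) by (auto simp: w_def)
  ultimately have "crosses n r x t (g', 0 < w)"
    using g' by (auto simp: crosses_def Let_def zero_less_mult_iff)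
  then show thesis
    using that g'(1) by simp
qed

lemma crosses_unique:
  assumes "crosses n r x t l" "crosses n r x t l'" "0 < t" "t < T"
  shows "l = l'"
proof -
  have "fst l = fst l'"
    using crosses_wall[OF assms(1)] crosses_wall[OF assms(2)] wall_unique[OF n r(1)]
    by (metis prod.collapse)
  moreover from this have "snd l = snd l'"
    using crosses_velocity[OF assms(1,3,4)] crosses_velocity[OF assms(2-4)]
    by (auto simp: letter_sign_def split: if_splits)
  ultimately show ?thesis
    by (simp add: prod_eq_iff)
qed

end

section \<open>Consecutive crossings\<close>

lemma reflect_sphere:
  assumes "p \<in> sphere c r" "0 < r"
  shows "reflect c p w = w - (2 * (w \<bullet> (p - c)) / r\<^sup>2) *\<^sub>R (p - c)"
proof -
  have "norm (p - c) = r"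
    using assms(1) by (simp add: dist_norm norm_minus_commute)
  then have "sgn (p - c) = (1 / r) *\<^sub>R (p - c)"
    by (simp add: sgn_div_norm divide_inverse)
  then show ?thesis
    by (simp add: reflect_def power2_eq_square)
qed

lemma fst_snd_le_norm:
  fixes p :: "real \<times> real"
  shows "\<bar>fst p\<bar> + 2 * \<bar>snd p\<bar> \<le> sqrt 5 * norm p"
proof -
  have "0 \<le> (2 * \<bar>fst p\<bar> - \<bar>snd p\<bar>)\<^sup>2"
    by simp
  then have "(\<bar>fst p\<bar> + 2 * \<bar>snd p\<bar>)\<^sup>2 \<le> 5 * ((fst p)\<^sup>2 + (snd p)\<^sup>2)"
    by (simp add: power2_diff power2_sum power_mult_distrib)
  then have "\<bar>fst p\<bar> + 2 * \<bar>snd p\<bar> \<le> sqrt (5 * ((fst p)\<^sup>2 + (snd p)\<^sup>2))"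
    by (rule real_le_rsqrt)
  then show ?thesis
    by (simp add: norm_prod_def flip: real_sqrt_mult)
qed

context billiard_trajectory
begin

text \<open>
  Crossings of parallel lines are compared by the coordinate that the letters cross, not by the
  generators: after \<open>b\<^sub>1\<close> the next row crossing may be \<open>b\<^sub>2\<close>.
\<close>

definition consecutive_crossings :: "real \<Rightarrow> letter \<Rightarrow> real \<Rightarrow> letter \<Rightarrow> bool" where
  "consecutive_crossings s l t l' \<longleftrightarrow> 0 < s \<and> s < t \<and> t < T \<and>
     crosses n r x s l \<and> crosses n r x t l' \<and> transversal (fst l') = transversal (fst l) \<and>
     (\<forall>u\<in>{s<..<t}. \<forall>m. crosses n r x u m \<longrightarrow> transversal (fst m) \<noteq> transversal (fst l))"

lemma consecutive_crossingsD:
  assumes "consecutive_crossings s l t l'"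
  shows "0 < s" "s < t" "t < T" "crosses n r x s l" "crosses n r x t l'"
    "transversal (fst l') = transversal (fst l)"
  using assms by (simp_all add: consecutive_crossings_def)

text \<open>
  Without a crossing in between, the set of times spent on the lines is open, since the trajectory
  has no transversal velocity at these times, and it is closed by continuity. By connectedness it is
  empty or everything, and \<open>u0\<close> excludes the latter.
\<close>

lemma no_wall_line_between:
  assumes "0 < s" "t < T"
    and none: "\<And>u m. u \<in> {s<..<t} \<Longrightarrow> crosses n r x u m \<Longrightarrow> transversal (fst m) \<noteq> transversal g"
    and u0: "u0 \<in> {s<..<t}" "transversal g (x u0) \<notin> \<int>"
    and u: "u \<in> {s<..<t}"
  shows "transversal g (x u) \<notin> \<int>"
proof -
  define A where "A = {u \<in> {s<..<t}. transversal g (x u) \<in> \<int>}"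
  define B where "B = {s<..<t} \<inter> (\<lambda>u. transversal g (x u)) -` (- \<int>)"
  have "open A"
  proof (rule Topological_Spaces.openI)
    fix u assume u: "u \<in> A"
    then have *: "0 < u" "u < T" "transversal g (x u) \<in> \<int>" "s < u" "u < t"
      using assms(1,2) by (auto simp: A_def)
    have "transversal g (v u) = 0"
      using exists_crosses[OF *(1-3)] none[of u] *(4,5) by (metis greaterThanLessThan_iff)
    then have "\<forall>\<^sub>F u' in nhds u. transversal g (x u') = transversal g (x u)"
      using locally_linear[OF *(1-3)] by simp
    moreover have "\<forall>\<^sub>F u' in nhds u. u' \<in> {s<..<t}"
      by (rule eventually_nhds_in_open) (use * in auto)
    ultimately have "\<forall>\<^sub>F u' in nhds u. u' \<in> A"
      by eventually_elim (use *(3) in \<open>auto simp: A_def\<close>)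
    then show "\<exists>S. open S \<and> u \<in> S \<and> S \<subseteq> A"
      by (auto simp: eventually_nhds)
  qed
  moreover have "open B"
    unfolding B_def
  proof (rule continuous_open_preimage)
    show "continuous_on {s<..<t} (\<lambda>u. transversal g (x u))"
      by (rule continuous_on_subset[OF continuous_on_transversal]) (use assms(1,2) in auto)
  qed auto
  moreover have "A \<inter> B \<inter> {s<..<t} = {}" "{s<..<t} \<subseteq> A \<union> B"
    by (auto simp: A_def B_def)
  ultimately have "A \<inter> {s<..<t} = {} \<or> B \<inter> {s<..<t} = {}"
    by (intro connectedD[OF connected_Ioo])
  moreover have "u0 \<in> B"
    using u0 by (simp add: B_def)
  ultimately show ?thesis
    using u u0(1) by (auto simp: A_def)
qed

text \<open>
  The coordinate \<open>h\<close> is measured from the first line, in the direction of the first crossing. Just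
  after this crossing \<open>h\<close> is in \<open>(0, 1)\<close>; it cannot leave this interval before the next line is
  met, and the direction in which that line is crossed tells which of the two ends was reached.
\<close>

lemma
  assumes consecutive: "consecutive_crossings s l t l'"
  defines "h \<equiv> \<lambda>u. letter_sign l * (transversal (fst l) (x u) - transversal (fst l) (x s))"
  shows between_consecutive_crossings: "u \<in> {s<..<t} \<Longrightarrow> h u \<in> {0<..<1}"
    and at_next_crossing: "h t = (if letter_sign l' = letter_sign l then 1 else 0)"
proof -
  note assms = consecutive_crossingsD(1-3)[OF consecutive]
    and l = consecutive_crossingsD(4)[OF consecutive]
    and l' = consecutive_crossingsD(5)[OF consecutive]
    and same = consecutive_crossingsD(6)[OF consecutive]
  define g where "g = fst l"
  define e e' where "e = real_of_int (letter_sign l)" and "e' = real_of_int (letter_sign l')"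
  define w w' where "w = transversal g (v s)" and "w' = transversal g (v t)"
  have h: "h u = e * (transversal g (x u) - transversal g (x s))" for u
    by (simp add: h_def e_def g_def)
  have e: "e = 1 \<or> e = - 1" "e' = 1 \<or> e' = - 1" "e \<in> \<int>"
    by (auto simp: e_def e'_def letter_sign_def)
  have ints: "transversal g (x s) \<in> \<int>" "transversal g (x t) \<in> \<int>"
    using crosses_transversal_Ints[OF l] crosses_transversal_Ints[OF l'] same by (simp_all add: g_def)
  have h_Ints: "transversal g (x u) \<in> \<int> \<longleftrightarrow> h u \<in> \<int>" for u
  proof
    assume "h u \<in> \<int>"
    moreover have "transversal g (x u) = e * h u + transversal g (x s)"
      using e by (auto simp: h)
    ultimately show "transversal g (x u) \<in> \<int>"
      using ints e by simp
  qed (use ints e in \<open>simp add: h\<close>)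
  have w: "0 < e * w" "0 < e' * w'"
    using crosses_velocity[OF l] crosses_velocity[OF l'] assms(1-3) same
    by (simp_all add: e_def e'_def w_def w'_def g_def)
  have lin: "\<forall>\<^sub>F u in nhds s. transversal g (x u) = transversal g (x s) + (u - s) * w"
      "\<forall>\<^sub>F u in nhds t. transversal g (x u) = transversal g (x t) + (u - t) * w'"
    using locally_linear[of s g] locally_linear[of t g] assms(1-3) ints
    by (simp_all add: w_def w'_def)
  obtain u0 where u0: "u0 \<in> {s<..<t}" "h u0 \<in> {0<..<1}"
  proof -
    \<comment> \<open>Before time \<open>s + 1 / (e * w)\<close> linear motion has covered less than the distance \<open>1\<close>.\<close>
    have "\<forall>\<^sub>F u in at_right s. transversal g (x u) = transversal g (x s) + (u - s) * w"
      using lin(1) by (auto simp: eventually_at_filter elim: eventually_mono)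
    moreover have "\<forall>\<^sub>F u in at_right s. u \<in> {s<..<t}"
      using assms(2) by (rule eventually_at_right_real)
    moreover have "\<forall>\<^sub>F u in at_right s. u \<in> {s<..<s + 1 / (e * w)}"
      by (rule eventually_at_right_real) (use w in simp)
    ultimately have "\<forall>\<^sub>F u in at_right s. u \<in> {s<..<t} \<and> h u \<in> {0<..<1}"
    proof eventually_elim
      case (elim u)
      have "h u = (u - s) * (e * w)"
        by (simp add: h elim(1))
      moreover have "(u - s) * (e * w) < 1"
      proof -
        have "u - s < 1 / (e * w)"
          using elim(3) by auto
        then show ?thesis
          using w(1) by (simp add: less_divide_eq)
      qed
      moreover have "0 < (u - s) * (e * w)"
        using elim(3) w(1) by (intro mult_pos_pos[OF _ w(1)]) simp
      ultimately show ?case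
        using elim(2) by simp
    qed
    then show thesis
      using that eventually_happens'[of "at_right s"] by (auto simp: trivial_limit_at_right_real)
  qed
  have no_Ints: "h u \<notin> \<int>" if "u \<in> {s<..<t}" for u
    unfolding h_Ints[symmetric]
  proof (rule no_wall_line_between[OF assms(1,3) _ u0(1) _ that])
    show "transversal g (x u0) \<notin> \<int>"
      unfolding h_Ints using u0(2) by (auto elim!: Ints_cases)
    show "transversal (fst m) \<noteq> transversal g" if "u \<in> {s<..<t}" "crosses n r x u m" for u m
      using that consecutive unfolding consecutive_crossings_def g_def by blast
  qed
  have "continuous_on {s<..<t} h"
    unfolding h
    by (intro continuous_intros continuous_on_subset[OF continuous_on_transversal])
       (use assms(1-3) in auto)
  then have conn: "connected (h ` {s<..<t})"
    by (intro connected_continuous_image connected_Ioo)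
  show between: "h u \<in> {0<..<1}" if u: "u \<in> {s<..<t}" for u
  proof (rule ccontr)
    assume "h u \<notin> {0<..<1}"
    then have "0 \<in> h ` {s<..<t} \<or> 1 \<in> h ` {s<..<t}"
      using connectedD_interval[OF conn, of "h u" "h u0" 0]
        connectedD_interval[OF conn, of "h u0" "h u" 1] u u0 by (auto simp: not_less)
    then show False
      using no_Ints by (metis Ints_0 Ints_1 imageE)
  qed
  obtain u1 where u1: "u1 \<in> {s<..<t}" "(t - u1) * (e' * w') \<in> {0<..<1}"
      "transversal g (x t) = transversal g (x u1) + (t - u1) * w'"
  proof -
    have "\<forall>\<^sub>F u in at_left t. transversal g (x u) = transversal g (x t) + (u - t) * w'"
      using lin(2) by (auto simp: eventually_at_filter elim: eventually_mono)
    moreover have "\<forall>\<^sub>F u in at_left t. u \<in> {s<..<t}"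
      using assms(2) by (rule eventually_at_left_real)
    moreover have "\<forall>\<^sub>F u in at_left t. u \<in> {t - 1 / (e' * w')<..<t}"
      by (rule eventually_at_left_real) (use w in simp)
    ultimately have "\<forall>\<^sub>F u in at_left t. u \<in> {s<..<t} \<and> (t - u) * (e' * w') \<in> {0<..<1} \<and>
        transversal g (x t) = transversal g (x u) + (t - u) * w'"
    proof eventually_elim
      case (elim u)
      have "t - u < 1 / (e' * w')"
        using elim(3) by auto
      then have "(t - u) * (e' * w') < 1"
        using w(2) by (simp add: less_divide_eq)
      moreover have "0 < (t - u) * (e' * w')"
        using elim(3) by (intro mult_pos_pos[OF _ w(2)]) simp
      ultimately show ?case
        using elim(1,2) by (simp add: algebra_simps)
    qed
    then show thesis
      using that eventually_happens'[of "at_left t"] by (auto simp: trivial_limit_at_left_real)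
  qed
  obtain k where k: "h t = of_int k"
    using ints(2) h_Ints by (auto elim: Ints_cases)
  have ht: "h t = h u1 + e * e' * ((t - u1) * (e' * w'))"
    using e(2) by (auto simp: h u1(3) algebra_simps)
  show "h t = (if letter_sign l' = letter_sign l then 1 else 0)"
  proof (cases "letter_sign l' = letter_sign l")
    case True
    then have "e * e' = 1"
      using e by (auto simp: e_def e'_def)
    then have "0 < h t" "h t < 2"
      using ht u1(2) between[OF u1(1)] by auto
    then have "k = 1"
      by (simp add: k)
    then show ?thesis
      using True k by simp
  next
    case False
    then have "e * e' = - 1"
      using e by (auto simp: e_def e'_def)
    then have "- 1 < h t" "h t < 1"
      using ht u1(2) between[OF u1(1)] by auto
    then have "k = 0"
      by (simp add: k)
    then show ?thesis
      using False k by simp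
  qed
qed

lemma consecutive_crossings_displacement:
  assumes "consecutive_crossings s l t l'"
  shows "transversal (fst l) (x t) - transversal (fst l) (x s) =
    (letter_sign l + letter_sign l') / 2"
  using at_next_crossing[OF assms] by (auto simp: letter_sign_def split: if_splits)

text \<open>
  The first line is a row. As long as the trajectory is less than \<open>1 - r\<close> away from it, the only
  disks that it can hit are those of that row. Being past the row, it hits the half of a disk whose
  normals point onwards, so the reflection adds to its velocity away from the row. Without coming
  within \<open>r\<close> of the next row it would therefore never return.
\<close>

lemma turning_time:
  assumes consecutive: "consecutive_crossings s l t l'"
    and snd: "transversal (fst l) = snd"
    and turn: "letter_sign l' \<noteq> letter_sign l"
  shows "2 * (1 - r) \<le> t - s"
proof -
  note assms = consecutive_crossingsD[OF consecutive]
  define e where "e = real_of_int (letter_sign l)"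
  define h where "h u = e * (snd (x u) - snd (x s))" for u
  define w where "w = e * snd (v s)"
  have e: "e = 1 \<or> e = - 1" "e \<in> \<int>"
    by (auto simp: e_def letter_sign_def)
  have w: "0 < w"
    using crosses_velocity[OF assms(4)] assms(1-3) by (simp add: w_def e_def snd)
  have h01: "0 < h u" "h u < 1" if "u \<in> {s<..<t}" for u
    using between_consecutive_crossings[OF consecutive that] by (simp_all add: h_def e_def snd)
  have ht: "h t = 0"
    using at_next_crossing[OF consecutive] turn by (simp add: h_def e_def snd)
  have hs: "h s = 0"
    by (simp add: h_def)
  have "\<exists>u\<in>{s<..<t}. 1 - r \<le> h u"
  proof (rule ccontr)
    assume "\<not> (\<exists>u\<in>{s<..<t}. 1 - r \<le> h u)"
    then have low: "h u < 1 - r" if "u \<in> {s<..<t}" for u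
      using that by force
    \<comment> \<open>The invariant speaks of velocities before \<open>t\<close> only, because reflections are controlled where \<open>h\<close> is positive.\<close>
    have "(t < t \<longrightarrow> w \<le> e * snd (v t)) \<and> w * (t - s) \<le> h t"
    proof (rule free_flight_induct[where s = s and t = t and
          P = "\<lambda>u. (u < t \<longrightarrow> w \<le> e * snd (v u)) \<and> w * (u - s) \<le> h u"])
      fix s' t'
      assume st': "s \<le> s'" "t' \<le> t" "free_between s' t'"
        and IH: "(s' < t \<longrightarrow> w \<le> e * snd (v s')) \<and> w * (s' - s) \<le> h s'"
      have "s' < t'"
        using st'(3) by (simp add: free_between_def)
      then have ws': "w \<le> e * snd (v s')"
        using IH st'(2) by simp
      have "w * (t' - s') \<le> e * snd (v s') * (t' - s')"
        using ws' \<open>s' < t'\<close> by (intro mult_right_mono) auto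
      moreover have "h t' = h s' + e * snd (v s') * (t' - s')"
        by (simp add: h_def free_betweenD(1)[OF st'(3)] algebra_simps)
      ultimately have "w * (t' - s) \<le> h t'"
        using IH by (simp add: algebra_simps)
      moreover have "w \<le> e * snd (v t')" if "t' < t"
      proof (cases "x t' \<in> bdry n r")
        case True
        then obtain c where c: "c \<in> centres n" "x t' \<in> sphere c r"
          by (auto simp: bdry_def)
        have t': "t' \<in> {s<..<t}"
          using that st'(1) \<open>s' < t'\<close> by auto
        have "e * (snd c - snd (x s)) \<in> \<int>"
          using e snd_centre_Ints[OF n c(1)] crosses_transversal_Ints[OF assms(4)]
          by (simp add: snd)
        then obtain k where k: "e * (snd c - snd (x s)) = of_int k"
          by (auto elim: Ints_cases)
        have "\<bar>snd (x t') - snd c\<bar> \<le> r"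
          using c(2) dist_snd_le[of "x t'" c] by (simp add: dist_real_def dist_commute)
        moreover have hk: "h t' - of_int k = e * (snd (x t') - snd c)"
          unfolding k[symmetric] h_def by (simp add: algebra_simps)
        ultimately have "\<bar>h t' - of_int k\<bar> \<le> r"
          using e by (auto simp: abs_mult)
        \<comment> \<open>The disk belongs to row \<open>k\<close>, counted from the first row in the direction of motion.\<close>
        then have "of_int k < (1::real)" "of_int k > (-1::real)"
          using low[OF t'] h01[OF t'] r by linarith+
        then have "k = 0"
          by simp
        then have up: "0 < e * snd (x t' - c)"
          using h01(1)[OF t'] hk by simp
        have "e * snd (v t') =
            e * snd (v s') - (2 * (v s' \<bullet> (x t' - c)) / r\<^sup>2) * (e * snd (x t' - c))"
          unfolding free_betweenD(3)[OF st'(3) c] reflect_sphere[OF c(2) r(1)]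
          by (simp only: snd_diff[of "v s'"] snd_scaleR real_scaleR_def
              right_diff_distrib[of e "snd (v s')"] mult.left_commute[of e])
        moreover have "(2 * (v s' \<bullet> (x t' - c)) / r\<^sup>2) * (e * snd (x t' - c)) \<le> 0"
          using incoming_velocity[OF st'(3) c] up
          by (intro mult_nonpos_nonneg[OF divide_nonpos_nonneg]) auto
        ultimately show ?thesis
          using ws' by linarith
      qed (use ws' free_betweenD(2)[OF st'(3)] in simp)
      ultimately show "(t' < t \<longrightarrow> w \<le> e * snd (v t')) \<and> w * (t' - s) \<le> h t'"
        by blast
    qed (use assms(1-3) w in \<open>auto simp: w_def hs\<close>)
    moreover have "0 < w * (t - s)"
      using w assms(2) by simp
    ultimately show False
      using ht by linarith
  qed
  then obtain u where u: "u \<in> {s<..<t}" "1 - r \<le> h u"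
    by blast
  have "h u = e * (snd (x u) - snd (x s))" "h u = e * (snd (x u) - snd (x t))"
    using ht by (simp_all add: h_def algebra_simps)
  then have "h u \<le> \<bar>snd (x u) - snd (x s)\<bar>" "h u \<le> \<bar>snd (x t) - snd (x u)\<bar>"
    using e(1) by auto
  moreover have "\<bar>snd (x u) - snd (x s)\<bar> \<le> u - s" "\<bar>snd (x t) - snd (x u)\<bar> \<le> t - u"
    using transversal_displacement_le[of s u "fst l"] transversal_displacement_le[of u t "fst l"]
      u(1) assms(1-3) by (simp_all add: snd)
  ultimately show ?thesis
    using u(2) by simp
qed

text \<open>
  If both crossings have the same direction, the time is split at \<open>u\<close> and \<open>u'\<close>: the
  middle chord alone accounts for the horizontal displacement, and the three chords together for the vertical displacement \<open>1\<close>.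
\<close>

lemma row_crossing_time:
  assumes consecutive: "consecutive_crossings s l t l'"
    and snd: "transversal (fst l) = snd"
    and u: "s \<le> u" "u \<le> u'" "u' \<le> t"
  shows "2 + \<bar>fst (x u') - fst (x u)\<bar> \<le> sqrt 5 * (t - s)"
proof (cases "letter_sign l' = letter_sign l")
  note assms = consecutive_crossingsD(1-3)[OF consecutive]
  case True
  have chord: "\<bar>fst (x b) - fst (x a)\<bar> + 2 * \<bar>snd (x b) - snd (x a)\<bar> \<le> sqrt 5 * (b - a)"
    if "s \<le> a" "a \<le> b" "b \<le> t" for a b
  proof -
    have "\<bar>fst (x b) - fst (x a)\<bar> + 2 * \<bar>snd (x b) - snd (x a)\<bar> \<le> sqrt 5 * norm (x b - x a)"
      using fst_snd_le_norm[of "x b - x a"] by simp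
    also have "\<dots> \<le> sqrt 5 * (b - a)"
      using displacement_le[of a b] that assms(1-3) by (intro mult_left_mono) auto
    finally show ?thesis .
  qed
  have "\<bar>snd (x t) - snd (x s)\<bar> = 1"
    using consecutive_crossings_displacement[OF consecutive] True
    by (simp add: snd letter_sign_def split: if_splits)
  then have up: "1 \<le> \<bar>snd (x u) - snd (x s)\<bar> + \<bar>snd (x u') - snd (x u)\<bar> + \<bar>snd (x t) - snd (x u')\<bar>"
    by linarith
  have "2 * \<bar>snd (x u) - snd (x s)\<bar> \<le> sqrt 5 * (u - s)"
      "2 * \<bar>snd (x t) - snd (x u')\<bar> \<le> sqrt 5 * (t - u')"
    using chord[of s u] chord[of u' t] u by linarith+
  moreover have "2 + d \<le> X + Y + Z"
    if "1 \<le> a + b + c" "d + 2 * b \<le> Y" "2 * a \<le> X" "2 * c \<le> Z" for a b c d X Y Z :: real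
    using that by linarith
  ultimately have "2 + \<bar>fst (x u') - fst (x u)\<bar> \<le> sqrt 5 * (u - s) + sqrt 5 * (u' - u) + sqrt 5 * (t - u')"
    using up chord[OF u] by blast
  then show ?thesis
    by (simp add: algebra_simps)
next
  note assms = consecutive_crossingsD(1-3)[OF consecutive]
  case False
  have ts: "9 / 5 \<le> t - s"
    using turning_time[OF consecutive snd False] r(3) by simp
  have "11 / 5 \<le> sqrt 5"
    by (rule real_le_rsqrt) (simp add: power2_eq_square)
  then have "11 / 5 * (t - s) \<le> sqrt 5 * (t - s)"
    using assms(2) by (intro mult_right_mono) auto
  moreover have "\<bar>fst (x u') - fst (x u)\<bar> \<le> t - s"
    using transversal_displacement_le[of u u' Gen_a] u assms(1-3) by simp
  ultimately show ?thesis
    using ts by simp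
qed

text \<open>
  The estimate for words applies with \<open>f\<close> the abscissa and \<open>g = a\<close>, because consecutive elements of
  the list of times with letter \<open>a\<close> are consecutive column crossings, and the remaining ones are
  consecutive row crossings.
\<close>

theorem length_homotopy_element_le: "length (homotopy_element n r T x) \<le> sqrt 5 * T + 3"
proof (cases "finite (crossing_times n r T x)")
  case True
  define S where "S = crossing_times n r T x"
  define L where "L t = (THE l. crosses n r x t l)" for t
  define ts where "ts = sorted_list_of_set S"
  have L: "crosses n r x t l \<Longrightarrow> L t = l" if "t \<in> {0<..<T}" for t l
    unfolding L_def using that crosses_unique by (intro the_equality) auto
  have S: "0 < t \<and> t < T \<and> crosses n r x t (L t)" if "t \<in> S" for t
    using that L[of t] by (auto simp: S_def crossing_times_def)
  have ts: "sorted_wrt (<) ts" "set ts = S"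
    using True by (simp_all add: ts_def S_def)
  have fst_snd: "(fst :: real \<times> real \<Rightarrow> real) \<noteq> snd"
    by (metis fst_conv snd_conv zero_neq_one)
  then have trans: "transversal g = fst \<longleftrightarrow> g = Gen_a" "transversal g = snd \<longleftrightarrow> g \<noteq> Gen_a" for g
    by (cases g; simp; metis)+
  have consecutive: "successively (\<lambda>s t. consecutive_crossings s (L s) t (L t) \<and> transversal (fst (L s)) = f)
      (filter (\<lambda>t. transversal (fst (L t)) = f) ts)" for f
  proof (rule successively_mono[OF successively_sorted_wrt_less[OF sorted_wrt_filter[OF ts(1)]]])
    fix s t
    let ?ts = "filter (\<lambda>t. transversal (fst (L t)) = f) ts"
    assume st: "s \<in> set ?ts \<and> t \<in> set ?ts \<and> s < t \<and> set ?ts \<inter> {s<..<t} = {}"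
    have False
      if u: "s < u" "u < t" "crosses n r x u m" "transversal (fst m) = f" for u m
    proof -
      have "u \<in> {0<..<T}"
        using u S[of s] S[of t] st by (auto simp: ts(2))
      then have "u \<in> S" "L u = m"
        using L u(3) by (auto simp: S_def crossing_times_def intro!: exI[of _ "fst m"] exI[of _ "snd m"])
      then have "u \<in> set ?ts \<inter> {s<..<t}"
        using u by (simp add: ts(2))
      then show False
        using st by blast
    qed
    then show "consecutive_crossings s (L s) t (L t) \<and> transversal (fst (L s)) = f"
      using st S[of s] S[of t] by (auto simp: ts(2) consecutive_crossings_def)
  qed
  have "length (free_reduce (map L ts)) \<le> sqrt 5 * T + 3"
  proof (rule length_free_reduce_le[where f = "\<lambda>t. fst (x t)" and g = Gen_a])
    show "\<bar>fst (x t) - fst (x s)\<bar> \<le> t - s" if "0 \<le> s" "s \<le> t" "t \<le> T" for s t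
      using transversal_displacement_le[OF that, of Gen_a] by simp
    show "set ts \<subseteq> {0..T}"
      using S by (force simp: ts(2))
    show "successively (\<lambda>s t. fst (x t) - fst (x s) =
        real_of_int (letter_sign (L s) + letter_sign (L t)) / 2) (filter (\<lambda>t. fst (L t) = Gen_a) ts)"
      using consecutive[of fst] unfolding trans
      by (rule successively_mono) (use consecutive_crossings_displacement in \<open>fastforce\<close>)
    show "successively (\<lambda>s t. \<forall>u u'. s \<le> u \<and> u \<le> u' \<and> u' \<le> t \<longrightarrow>
          2 + \<bar>fst (x u') - fst (x u)\<bar> \<le> sqrt 5 * (t - s)) (filter (\<lambda>t. fst (L t) \<noteq> Gen_a) ts)"
      using consecutive[of snd] unfolding trans
      by (rule successively_mono) (use row_crossing_time trans(2) in blast)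
  qed (use T_nonneg ts(1) in auto)
  then show ?thesis
    by (simp add: homotopy_element_def crossing_word_def L_def[abs_def] ts_def S_def)
next
  case False
  \<comment> \<open>An infinite set is listed as \<open>[]\<close>, and the word is empty.\<close>
  then show ?thesis
    using T_nonneg by (simp add: homotopy_element_def crossing_word_def)
qed

end

section \<open>The rotation set\<close>

theorem theorem2p1:
  fixes n :: nat
  assumes "1 \<le> n"
  shows "\<exists>r0>0. \<forall>r::real. 0 < r \<and> r < r0 \<longrightarrow> rotation_set n r \<subseteq> cone_ball n (2 * sqrt 2)"
proof (intro exI conjI allI impI subsetI)
  show "0 < min (1 / real n) (1 / 10)"
    using assms by simp
next
  fix r p
  assume r: "0 < r \<and> r < min (1 / real n) (1 / 10)" and "p \<in> rotation_set n r"
  then obtain s e T x v where p: "p = cone_point n s e" "0 \<le> s" "e \<in> Ends n"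
    and traj: "\<And>m. trajectory n r (T m) (x m) (v m)"
    and T: "filterlim T at_top sequentially"
    and lim: "(\<lambda>m. real (length (homotopy_element n r (T m) (x m))) / T m) \<longlonglongrightarrow> s"
    unfolding rotation_set_def by blast
  have bound: "length (homotopy_element n r (T m) (x m)) \<le> sqrt 5 * T m + 3" for m
  proof -
    interpret billiard_trajectory n r "T m" "x m" "v m"
      by unfold_locales (use assms r traj in auto)
    show ?thesis
      by (rule length_homotopy_element_le)
  qed
  have "(\<lambda>m. sqrt 5 + 3 / T m) \<longlonglongrightarrow> sqrt 5 + 0"
    by (intro tendsto_intros tendsto_divide_0[OF tendsto_const filterlim_at_top_imp_at_infinity[OF T]])
  moreover have "\<forall>\<^sub>F m in sequentially.
      real (length (homotopy_element n r (T m) (x m))) / T m \<le> sqrt 5 + 3 / T m"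
    using T[unfolded filterlim_at_top_dense, rule_format, of 0]
  proof eventually_elim
    case (elim m)
    then show ?case
      using bound[of m] by (simp add: field_simps)
  qed
  ultimately have "s \<le> sqrt 5 + 0"
    using lim by (intro tendsto_le[OF sequentially_bot])
  also have "sqrt 5 + 0 \<le> sqrt (2\<^sup>2 * 2)"
    by simp
  also have "sqrt (2\<^sup>2 * 2) = 2 * sqrt 2"
    by (simp only: real_sqrt_mult) simp
  finally show "p \<in> cone_ball n (2 * sqrt 2)"
    using p by (auto simp: cone_ball_def)
qed

end
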